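(* Let $X$ be a Banach space with $\dim X\ge 2$, let $\alpha,\beta,\gamma>0$ with $\beta\le\gamma$, let $p\ge 1$ and let $\varepsilon\in(1,2]$. If $$C_{\mathrm{NJ}}^p(\alpha,\beta,\gamma,X)<\frac{\alpha^{p/2}(\beta+\gamma)^p+\beta^{p/2}(\alpha+\gamma)^p(\varepsilon-1)^p}{2^{p-2}\left(\alpha^{p/2}\beta^{p/2}+\gamma^p\right)\left(\alpha^{p/2}+\beta^{p/2}\right)},$$ then $\delta_X(\varepsilon)>0$.
   Context: For a Banach space $X$, $\alpha,\beta,\gamma>0$ and real $p\ge 1$, define $$C_{\mathrm{NJ}}^p(\alpha,\beta,\gamma,X)=\sup\left\{\frac{\alpha^{p/2}\|\beta x+\gamma y\|^p+\beta^{p/2}\|\gamma x-\alpha y\|^p}{2^{p-2}\left[(\alpha\beta)^{p/2}+\gamma^p\right]\left(\beta^{p/2}\|x\|^p+\alpha^{p/2}\|y\|^p\right)}: x,y\in X,\ (x,y)\ne(0,0)\right\}.$$ $S_X=\{x\in X:\|x\|=1\}$ is the unit sphere. The modulus of convexity of $X$ is, for $\varepsilon\in[0,2]$, $$\delta_X(\varepsilon)=\inf\left\{1-\frac{\|x+y\|}{2}: x,y\in S_X,\ \|x-y\|=\varepsilon\right\}.$$ *)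

theory Defs
  imports "HOL-Analysis.Analysis"
begin

definition CNJ_quotient ::
  "real \<Rightarrow> real \<Rightarrow> real \<Rightarrow> real \<Rightarrow> 'a::real_normed_vector \<Rightarrow> 'a \<Rightarrow> real" where
  "CNJ_quotient p \<alpha> \<beta> \<gamma> x y =
     (\<alpha> powr (p / 2) * norm (\<beta> *\<^sub>R x + \<gamma> *\<^sub>R y) powr p
        + \<beta> powr (p / 2) * norm (\<gamma> *\<^sub>R x - \<alpha> *\<^sub>R y) powr p)
     / (2 powr (p - 2) * ((\<alpha> * \<beta>) powr (p / 2) + \<gamma> powr p)
        * (\<beta> powr (p / 2) * norm x powr p + \<alpha> powr (p / 2) * norm y powr p))"

(* The supremum is taken in the reals; it is genuine (not a default value) for every
   nontrivial space by lemma bdd_above_CNJ_quotient below. *)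
definition CNJ ::
  "real \<Rightarrow> real \<Rightarrow> real \<Rightarrow> real \<Rightarrow> 'a::real_normed_vector itself \<Rightarrow> real" where
  "CNJ p \<alpha> \<beta> \<gamma> X = Sup {CNJ_quotient p \<alpha> \<beta> \<gamma> x y | x y :: 'a. (x, y) \<noteq> (0, 0)}"

(* The set is bounded below by 0. It is nonempty for 0 \<le> \<epsilon> \<le> 2 if the space has dimension
   at least 2; on an empty set the real infimum is an unspecified default value. *)
definition modulus_of_convexity :: "'a::real_normed_vector itself \<Rightarrow> real \<Rightarrow> real" where
  "modulus_of_convexity X \<epsilon> =
     Inf {1 - norm (x + y) / 2 | x y :: 'a.
            x \<in> sphere 0 1 \<and> y \<in> sphere 0 1 \<and> norm (x - y) = \<epsilon>}"

lemma bdd_above_CNJ_quotient: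
  fixes p \<alpha> \<beta> \<gamma> :: real
  assumes "\<alpha> > 0" "\<beta> > 0" "\<gamma> > 0" "p \<ge> 1"
  shows "bdd_above {CNJ_quotient p \<alpha> \<beta> \<gamma> x y | x y :: 'a::real_normed_vector. (x, y) \<noteq> (0, 0)}"
proof (rule bdd_aboveI)
  let ?a = "\<alpha> powr (p / 2)" and ?b = "\<beta> powr (p / 2)"
  let ?c = "2 powr (p - 2) * ((\<alpha> * \<beta>) powr (p / 2) + \<gamma> powr p)"
  let ?K = "?a * (\<beta> + \<gamma>) powr p + ?b * (\<gamma> + \<alpha>) powr p"
  have pos: "?a > 0" "?b > 0" "?c > 0" "?K \<ge> 0"
    using assms by (auto intro!: mult_pos_pos add_pos_pos add_nonneg_nonneg)
  fix q
  assume "q \<in> {CNJ_quotient p \<alpha> \<beta> \<gamma> x y | x y :: 'a. (x, y) \<noteq> (0, 0)}"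
  then obtain x y :: 'a where xy: "(x, y) \<noteq> (0, 0)" and q: "q = CNJ_quotient p \<alpha> \<beta> \<gamma> x y"
    by blast
  define m where "m = max (norm x) (norm y)"
  have m: "m > 0" "norm x \<le> m" "norm y \<le> m"
    using xy by (auto simp: m_def less_max_iff_disj)
  have "norm (\<beta> *\<^sub>R x + \<gamma> *\<^sub>R y) \<le> \<beta> * norm x + \<gamma> * norm y"
    using assms norm_triangle_ineq[of "\<beta> *\<^sub>R x" "\<gamma> *\<^sub>R y"] by simp
  also have "\<dots> \<le> (\<beta> + \<gamma>) * m"
    using assms m by (simp add: distrib_right add_mono)
  finally have 1: "norm (\<beta> *\<^sub>R x + \<gamma> *\<^sub>R y) powr p \<le> (\<beta> + \<gamma>) powr p * m powr p"
    using assms m by (subst powr_mult[symmetric]) (auto intro!: powr_mono2)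
  have "norm (\<gamma> *\<^sub>R x - \<alpha> *\<^sub>R y) \<le> \<gamma> * norm x + \<alpha> * norm y"
    using assms norm_triangle_ineq4[of "\<gamma> *\<^sub>R x" "\<alpha> *\<^sub>R y"] by simp
  also have "\<dots> \<le> (\<gamma> + \<alpha>) * m"
    using assms m by (simp add: distrib_right add_mono)
  finally have 2: "norm (\<gamma> *\<^sub>R x - \<alpha> *\<^sub>R y) powr p \<le> (\<gamma> + \<alpha>) powr p * m powr p"
    using assms m by (subst powr_mult[symmetric]) (auto intro!: powr_mono2)
  have num: "?a * norm (\<beta> *\<^sub>R x + \<gamma> *\<^sub>R y) powr p + ?b * norm (\<gamma> *\<^sub>R x - \<alpha> *\<^sub>R y) powr p
      \<le> ?K * m powr p"
    using add_mono[OF mult_left_mono[OF 1, of ?a] mult_left_mono[OF 2, of ?b]]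
    by (simp add: algebra_simps)
  have "min ?a ?b * m powr p \<le> ?b * norm x powr p + ?a * norm y powr p"
  proof (cases "m = norm x")
    case True
    have "min ?a ?b * m powr p \<le> ?b * m powr p"
      by (intro mult_right_mono) auto
    also have "\<dots> \<le> ?b * norm x powr p + ?a * norm y powr p"
      using True by simp
    finally show ?thesis .
  next
    case False
    then have eq: "m = norm y" by (auto simp: m_def max_def split: if_splits)
    have "min ?a ?b * m powr p \<le> ?a * m powr p"
      by (intro mult_right_mono) auto
    also have "\<dots> \<le> ?b * norm x powr p + ?a * norm y powr p"
      using eq by simp
    finally show ?thesis .
  qed
  then have den: "?c * (min ?a ?b * m powr p) \<le> ?c * (?b * norm x powr p + ?a * norm y powr p)"
    by (rule mult_left_mono) (use pos in linarith)
  have "q \<le> (?K * m powr p) / (?c * (min ?a ?b * m powr p))"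
    unfolding q CNJ_quotient_def
    by (rule frac_le[OF _ num _ den]) (use pos m in \<open>auto intro!: mult_pos_pos mult_nonneg_nonneg\<close>)
  also have "\<dots> = ?K / (?c * min ?a ?b)"
    using m by (simp add: divide_simps)
  finally show "q \<le> ?K / (?c * min ?a ?b)" .
qed

end

theory Submission
  imports Defs
begin

text \<open>
  If the modulus of convexity vanishes at \<open>\<epsilon>\<close>, there are unit vectors \<open>x\<close>, \<open>y\<close> at distance \<open>\<epsilon>\<close>
  whose midpoint is almost a unit vector. Testing the supremum \<open>CNJ\<close> on this single pair suffices.
  The first term of the numerator is governed by
  \<open>\<beta> x + \<gamma> y = \<gamma> (x + y) - (\<gamma> - \<beta>) x\<close>, whose norm is nearly \<open>\<beta> + \<gamma>\<close>; this is where \<open>\<beta> \<le> \<gamma>\<close> enters.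
  The second is governed by a similar splitting of \<open>\<gamma> x - \<alpha> y\<close> into a multiple of \<open>x - y\<close> and a
  remainder, which gives norm at least \<open>(\<alpha> + \<gamma>) (\<epsilon> - 1)\<close> with no error term
  (lemma \<open>norm_weighted_diff_ge\<close>). As the midpoint approaches the sphere, the quotients
  are bounded below by numbers that tend to the stated threshold, so \<open>CNJ\<close> cannot lie below it.

  To read this off from the infimum, unit vectors at distance exactly \<open>\<epsilon>\<close> must exist, as the
  infimum of the empty set carries no information. They are found in a plane by the
  intermediate value theorem (lemma \<open>unit_vectors_at_distance\<close>).
\<close>

text \<open>
  Normalising the half turn \<open>cos t u + sin t v\<close> in a plane gives a path on the unit sphere from a
  unit vector to its antipode; along it the distance from the start varies continuously from 0 to 2.
\<close>

lemma unit_vectors_at_distance: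
  fixes B :: "'a::real_normed_vector set"
  assumes "independent B" "card B = 2" "0 \<le> \<epsilon>" "\<epsilon> \<le> 2"
  obtains x y :: 'a where "norm x = 1" "norm y = 1" "norm (x - y) = \<epsilon>"
proof -
  obtain u v where B: "B = {u, v}" "u \<noteq> v"
    using \<open>card B = 2\<close> by (auto simp: card_2_iff)
  have zero: "s = 0 \<and> t = 0" if "s *\<^sub>R u + t *\<^sub>R v = 0" for s t
  proof -
    have *: "(\<Sum>w\<in>B. (if w = u then s else t) *\<^sub>R w) = 0"
      using that B by simp
    have "(if w = u then s else t) = 0" if "w \<in> B" for w
      using independentD[OF \<open>independent B\<close> _ subset_refl * that] B by simp
    from this[of u] this[of v] show ?thesis using B by auto
  qed
  define w where "w t = cos t *\<^sub>R u + sin t *\<^sub>R v" for t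
  have w_nonzero: "w t \<noteq> 0" for t
    using zero[of "cos t" "sin t"] sin_zero_abs_cos_one[of t] by (auto simp: w_def)
  define z where "z t = w t /\<^sub>R norm (w t)" for t
  have z_unit: "norm (z t) = 1" for t
    using w_nonzero by (simp add: z_def)
  have w_ends: "w 0 = u" "w pi = - u"
    by (simp_all add: w_def)
  have "u \<noteq> 0"
    using w_nonzero[of 0] by (simp add: w_ends)
  have "z 0 - z pi = (2 / norm u) *\<^sub>R u"
    by (simp add: z_def w_ends scaleR_left_distrib[symmetric] field_simps)
  then have dist_end: "norm (z 0 - z pi) = 2"
    using \<open>u \<noteq> 0\<close> by simp
  have "continuous_on {0..pi} (\<lambda>t. norm (z 0 - z t))"
    using w_nonzero unfolding z_def w_def by (intro continuous_intros) auto
  then obtain t where "norm (z 0 - z t) = \<epsilon>"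
    using IVT'[of "\<lambda>t. norm (z 0 - z t)" 0 \<epsilon> pi] assms dist_end by auto
  then show thesis
    using that z_unit by blast
qed

lemma norm_weighted_sum_ge:
  fixes x y :: "'a::real_normed_vector"
  assumes "norm x = 1" "0 \<le> \<gamma>" "\<beta> \<le> \<gamma>"
  shows "\<beta> + \<gamma> - \<gamma> * (2 - norm (x + y)) \<le> norm (\<beta> *\<^sub>R x + \<gamma> *\<^sub>R y)"
proof -
  have "\<beta> *\<^sub>R x + \<gamma> *\<^sub>R y = \<gamma> *\<^sub>R (x + y) - (\<gamma> - \<beta>) *\<^sub>R x"
    by (simp add: algebra_simps)
  then have "norm (\<beta> *\<^sub>R x + \<gamma> *\<^sub>R y) \<ge> \<gamma> * norm (x + y) - (\<gamma> - \<beta>)"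
    using norm_triangle_ineq2[of "\<gamma> *\<^sub>R (x + y)" "(\<gamma> - \<beta>) *\<^sub>R x"] assms by simp
  then show ?thesis
    by (simp add: algebra_simps)
qed

text \<open>
  Splitting off \<open>x - y\<close> with the larger of the two weights gives
  \<open>max \<alpha> \<gamma> (d - 1) + min \<alpha> \<gamma>\<close> for \<open>d = \<parallel>x - y\<parallel>\<close>, and \<open>d \<le> 2\<close> makes the second summand at least
  \<open>min \<alpha> \<gamma> (d - 1)\<close>.
\<close>

lemma norm_weighted_diff_ge:
  fixes x y :: "'a::real_normed_vector"
  assumes "norm x = 1" "norm y = 1" "0 \<le> \<alpha>" "0 \<le> \<gamma>"
  shows "(\<alpha> + \<gamma>) * (norm (x - y) - 1) \<le> norm (\<gamma> *\<^sub>R x - \<alpha> *\<^sub>R y)"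
proof -
  have d: "norm (x - y) - 1 \<le> 1"
    using norm_triangle_ineq4[of x y] assms by simp
  show ?thesis
  proof (cases "\<alpha> \<le> \<gamma>")
    case True
    have "\<gamma> *\<^sub>R x - \<alpha> *\<^sub>R y = \<gamma> *\<^sub>R (x - y) + (\<gamma> - \<alpha>) *\<^sub>R y"
      by (simp add: algebra_simps)
    then have "norm (\<gamma> *\<^sub>R x - \<alpha> *\<^sub>R y) \<ge> \<gamma> * norm (x - y) - (\<gamma> - \<alpha>)"
      using norm_diff_ineq[of "\<gamma> *\<^sub>R (x - y)" "(\<gamma> - \<alpha>) *\<^sub>R y"] assms True by simp
    then show ?thesis
      using mult_left_mono[OF d \<open>0 \<le> \<alpha>\<close>] by (simp add: algebra_simps)
  next
    case False
    have "\<gamma> *\<^sub>R x - \<alpha> *\<^sub>R y = \<alpha> *\<^sub>R (x - y) - (\<alpha> - \<gamma>) *\<^sub>R x"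
      by (simp add: algebra_simps)
    then have "norm (\<gamma> *\<^sub>R x - \<alpha> *\<^sub>R y) \<ge> \<alpha> * norm (x - y) - (\<alpha> - \<gamma>)"
      using norm_triangle_ineq2[of "\<alpha> *\<^sub>R (x - y)" "(\<alpha> - \<gamma>) *\<^sub>R x"] assms False by simp
    then show ?thesis
      using mult_left_mono[OF d \<open>0 \<le> \<gamma>\<close>] by (simp add: algebra_simps)
  qed
qed

text \<open>
  With \<open>\<parallel>x - y\<parallel> = \<epsilon>\<close>, the lower bound at \<open>\<eta> = 0\<close> is the threshold of the theorem; \<open>\<eta>\<close> measures
  how far the midpoint may be from the sphere. The last assumption keeps the base
  of the first power nonnegative, where the power is monotone.
\<close>

lemma CNJ_ge_of_unit_vectors:
  fixes x y :: "'a::real_normed_vector"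
  assumes pos: "\<alpha> > 0" "\<beta> > 0" "\<gamma> > 0" "\<beta> \<le> \<gamma>" "p \<ge> 1"
    and unit: "norm x = 1" "norm y = 1"
    and dist: "1 \<le> norm (x - y)"
    and mid: "1 - norm (x + y) / 2 \<le> \<eta>"
    and small: "0 \<le> \<beta> + \<gamma> - 2 * \<gamma> * \<eta>"
  shows "(\<alpha> powr (p / 2) * (\<beta> + \<gamma> - 2 * \<gamma> * \<eta>) powr p
           + \<beta> powr (p / 2) * (\<alpha> + \<gamma>) powr p * (norm (x - y) - 1) powr p)
         / (2 powr (p - 2) * (\<alpha> powr (p / 2) * \<beta> powr (p / 2) + \<gamma> powr p)
            * (\<alpha> powr (p / 2) + \<beta> powr (p / 2)))
         \<le> CNJ p \<alpha> \<beta> \<gamma> TYPE('a)"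
    (is "?N / ?D \<le> _")
proof -
  have "\<gamma> * (2 - norm (x + y)) \<le> 2 * \<gamma> * \<eta>"
    using mult_left_mono[of "2 - norm (x + y)" "2 * \<eta>" \<gamma>] mid pos by (simp add: ac_simps)
  then have "\<beta> + \<gamma> - 2 * \<gamma> * \<eta> \<le> norm (\<beta> *\<^sub>R x + \<gamma> *\<^sub>R y)"
    using norm_weighted_sum_ge[of x \<gamma> \<beta> y] unit pos by linarith
  then have sum: "(\<beta> + \<gamma> - 2 * \<gamma> * \<eta>) powr p \<le> norm (\<beta> *\<^sub>R x + \<gamma> *\<^sub>R y) powr p"
    using small pos by (intro powr_mono2) auto
  have "((\<alpha> + \<gamma>) * (norm (x - y) - 1)) powr p \<le> norm (\<gamma> *\<^sub>R x - \<alpha> *\<^sub>R y) powr p"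
    using norm_weighted_diff_ge[of x y \<alpha> \<gamma>] unit pos dist
    by (intro powr_mono2) auto
  then have diff: "(\<alpha> + \<gamma>) powr p * (norm (x - y) - 1) powr p
      \<le> norm (\<gamma> *\<^sub>R x - \<alpha> *\<^sub>R y) powr p"
    using pos dist by (simp add: powr_mult)
  have "?N \<le> \<alpha> powr (p / 2) * norm (\<beta> *\<^sub>R x + \<gamma> *\<^sub>R y) powr p
      + \<beta> powr (p / 2) * norm (\<gamma> *\<^sub>R x - \<alpha> *\<^sub>R y) powr p" (is "_ \<le> ?M")
    using sum diff by (simp add: mult.assoc add_mono mult_left_mono)
  then have "?N / ?D \<le> ?M / ?D"
    by (rule divide_right_mono) simp
  also have "\<dots> = CNJ_quotient p \<alpha> \<beta> \<gamma> x y"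
    using unit pos by (simp add: CNJ_quotient_def powr_mult add.commute)
  also have "\<dots> \<le> CNJ p \<alpha> \<beta> \<gamma> TYPE('a)"
    unfolding CNJ_def
  proof (rule cSup_upper[OF _ bdd_above_CNJ_quotient])
    have "(x, y) \<noteq> (0, 0)"
      using unit by auto
    then show "CNJ_quotient p \<alpha> \<beta> \<gamma> x y
        \<in> {CNJ_quotient p \<alpha> \<beta> \<gamma> x y | x y :: 'a. (x, y) \<noteq> (0, 0)}"
      by blast
  qed (use pos in auto)
  finally show ?thesis .
qed

text \<open>
  Nonemptiness of the set of competitors is what allows a strict upper bound on the infimum to be
  realised by an actual pair.
\<close>

lemma modulus_of_convexity_lessD:
  fixes B :: "'a::real_normed_vector set"
  assumes B: "independent B" "card B = 2" and "0 \<le> \<epsilon>" "\<epsilon> \<le> 2"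
    and less: "modulus_of_convexity TYPE('a) \<epsilon> < \<eta>"
  obtains x y :: 'a where "norm x = 1" "norm y = 1" "norm (x - y) = \<epsilon>"
    "1 - norm (x + y) / 2 < \<eta>"
proof -
  obtain a b :: 'a where "norm a = 1" "norm b = 1" "norm (a - b) = \<epsilon>"
    using unit_vectors_at_distance[OF B \<open>0 \<le> \<epsilon>\<close> \<open>\<epsilon> \<le> 2\<close>] by blast
  then have "{1 - norm (x + y) / 2 | x y :: 'a.
      x \<in> sphere 0 1 \<and> y \<in> sphere 0 1 \<and> norm (x - y) = \<epsilon>} \<noteq> {}"
    by auto
  from cInf_lessD[OF this less[unfolded modulus_of_convexity_def]] show thesis
    using that by auto
qed

theorem theorem3:
  fixes \<alpha> \<beta> \<gamma> p \<epsilon> :: real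
  assumes "\<exists>B :: 'a::banach set. independent B \<and> card B = 2"
    and "\<alpha> > 0" and "\<beta> > 0" and "\<gamma> > 0" and "\<beta> \<le> \<gamma>"
    and "p \<ge> 1"
    and "\<epsilon> \<in> {1<..2}"
    and "CNJ p \<alpha> \<beta> \<gamma> TYPE('a) <
      (\<alpha> powr (p / 2) * (\<beta> + \<gamma>) powr p
         + \<beta> powr (p / 2) * (\<alpha> + \<gamma>) powr p * (\<epsilon> - 1) powr p)
      / (2 powr (p - 2) * (\<alpha> powr (p / 2) * \<beta> powr (p / 2) + \<gamma> powr p)
         * (\<alpha> powr (p / 2) + \<beta> powr (p / 2)))"
  shows "modulus_of_convexity TYPE('a) \<epsilon> > 0"
proof (rule ccontr)
  assume "\<not> modulus_of_convexity TYPE('a) \<epsilon> > 0"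
  then have mod: "modulus_of_convexity TYPE('a) \<epsilon> \<le> 0"
    by simp
  define lower where "lower \<eta> = (\<alpha> powr (p / 2) * (\<beta> + \<gamma> - 2 * \<gamma> * \<eta>) powr p
         + \<beta> powr (p / 2) * (\<alpha> + \<gamma>) powr p * (\<epsilon> - 1) powr p)
      / (2 powr (p - 2) * (\<alpha> powr (p / 2) * \<beta> powr (p / 2) + \<gamma> powr p)
         * (\<alpha> powr (p / 2) + \<beta> powr (p / 2)))" for \<eta>
  have base: "((\<lambda>\<eta>. \<beta> + \<gamma> - 2 * \<gamma> * \<eta>) \<longlongrightarrow> \<beta> + \<gamma> - 2 * \<gamma> * 0) (at_right 0)"
    by (intro tendsto_intros)
  then have "(lower \<longlongrightarrow> lower 0) (at_right 0)"
    unfolding lower_def divide_inverse using assms by (intro tendsto_intros) auto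
  moreover have "CNJ p \<alpha> \<beta> \<gamma> TYPE('a) < lower 0"
    using assms by (simp add: lower_def)
  ultimately have "\<forall>\<^sub>F \<eta> in at_right 0. CNJ p \<alpha> \<beta> \<gamma> TYPE('a) < lower \<eta>"
    by (rule order_tendstoD)
  moreover have "\<forall>\<^sub>F \<eta> in at_right 0. 0 < \<beta> + \<gamma> - 2 * \<gamma> * \<eta>"
    using assms by (intro order_tendstoD(1)[OF base]) simp
  ultimately have "\<forall>\<^sub>F \<eta> in at_right 0. CNJ p \<alpha> \<beta> \<gamma> TYPE('a) < lower \<eta>
      \<and> 0 < \<beta> + \<gamma> - 2 * \<gamma> * \<eta> \<and> 0 < \<eta>"
    using eventually_at_right_less[of "0::real"] by eventually_elim simp
  then obtain \<eta> where \<eta>: "CNJ p \<alpha> \<beta> \<gamma> TYPE('a) < lower \<eta>"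
      "0 < \<beta> + \<gamma> - 2 * \<gamma> * \<eta>" "0 < \<eta>"
    using eventually_happens'[OF trivial_limit_at_right_real] by blast
  obtain B :: "'a set" where "independent B" "card B = 2"
    using assms(1) by blast
  then obtain x y :: 'a where "norm x = 1" "norm y = 1" "norm (x - y) = \<epsilon>"
      "1 - norm (x + y) / 2 < \<eta>"
    using modulus_of_convexity_lessD[of B \<epsilon> \<eta>] mod \<eta> assms(7) by auto
  then have "lower \<eta> \<le> CNJ p \<alpha> \<beta> \<gamma> TYPE('a)"
    using CNJ_ge_of_unit_vectors[of \<alpha> \<beta> \<gamma> p x y \<eta>] assms \<eta> by (simp add: lower_def)
  with \<eta> show False
    by simp
qed

end
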